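(* Let $n\geq 2$ and $1\leq k\leq n$. Then $$\mathsf{R}_{k}=\{ \alpha\in \mathcal{O}_{n} : k\in \mathrm{im}(\alpha) \text{ and } k\alpha^{-1} \neq \{k\}\}.$$ Moreover, $\lvert \mathsf{R}_{1}\rvert= \lvert \mathsf{R}_{n} \rvert= \binom{2n-3}{n-1}$, and $\lvert \mathsf{R}_{k} \rvert= \binom{2n-2}{n-1} -\binom{2k-3}{k-2} \binom{2n-2k-1}{n-k-1}$ for $2\leq k\leq n-1$.
   Context: For a positive integer $n$, let $X_n=\{1<2<\cdots<n\}$ and let $\mathcal{O}_n$ be the semigroup of all order-preserving maps $\alpha: X_n\to X_n$ (i.e. $x<y$ implies $x\alpha\leq y\alpha$) under composition. Maps are written on the right and composed left to right: $x(\alpha\beta)=(x\alpha)\beta$. The image is $\mathrm{im}(\alpha)=\{x\alpha: x\in X_n\}$, and $k\alpha^{-1}=\{x\in X_n: x\alpha=k\}$ is the preimage of $k$. For $1\leq k\leq n$, $\pi_k\in\mathcal{O}_n$ is the constant map $x\pi_k=k$ for all $x\in X_n$. For $1\leq k\leq n$, define $$\mathsf{R}_{k} = \{ \alpha \in \mathcal{O}_{n} : \gamma \alpha =\pi_{k} \text{ for some } \gamma \in \mathcal{O}_{n}\setminus\{\pi_k\} \}.$$ *)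

theory Defs
  imports Complex_Main "HOL-Library.FuncSet"
begin

definition X :: "nat \<Rightarrow> nat set" where
  "X n = {1..n}"

text \<open>A map from \<open>X n\<close> to itself is an extensional function, so that two maps are equal
  as soon as they agree on \<open>X n\<close>.\<close>

definition OP :: "nat \<Rightarrow> (nat \<Rightarrow> nat) set" where
  "OP n = {\<alpha> \<in> X n \<rightarrow>\<^sub>E X n. mono_on (X n) \<alpha>}"

text \<open>Composition is from left to right: \<open>\<alpha>\<close> is applied first.\<close>

definition mult :: "nat \<Rightarrow> (nat \<Rightarrow> nat) \<Rightarrow> (nat \<Rightarrow> nat) \<Rightarrow> (nat \<Rightarrow> nat)" where
  "mult n \<alpha> \<beta> = compose (X n) \<beta> \<alpha>"

definition im :: "nat \<Rightarrow> (nat \<Rightarrow> nat) \<Rightarrow> nat set" where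
  "im n \<alpha> = \<alpha> ` X n"

definition preimage :: "nat \<Rightarrow> (nat \<Rightarrow> nat) \<Rightarrow> nat \<Rightarrow> nat set" where
  "preimage n \<alpha> k = {x \<in> X n. \<alpha> x = k}"

definition const_map :: "nat \<Rightarrow> nat \<Rightarrow> (nat \<Rightarrow> nat)" where
  "const_map n k = (\<lambda>x\<in>X n. k)"

definition R :: "nat \<Rightarrow> nat \<Rightarrow> (nat \<Rightarrow> nat) set" where
  "R n k = {\<alpha> \<in> OP n. \<exists>\<gamma> \<in> OP n - {const_map n k}. mult n \<gamma> \<alpha> = const_map n k}"

end

theory Submission
  imports Defs
begin

text \<open>A factorisation of the constant map \<open>k\<close> as \<open>\<gamma>\<close> followed by \<open>\<alpha>\<close> says exactly that \<open>\<gamma>\<close> takes all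
  its values in the preimage of \<open>k\<close> under \<open>\<alpha>\<close>.  Hence such a \<open>\<gamma>\<close> other than the constant map \<open>k\<close>
  exists iff the preimage has an element \<open>j \<noteq> k\<close> (take \<open>\<gamma>\<close> constant with value \<open>j\<close>).  This is
  the description of \<open>R n k\<close>.

  For the cardinality, one counts order-preserving maps between finite chains: there are
  \<open>(p + m - 1) choose m\<close> of them from an \<open>m\<close>-chain to a \<open>p\<close>-chain (\<open>card_mono_maps\<close>).  The maps
  that miss \<open>k\<close> are the maps into a chain with \<open>n - 1\<close> elements, so by Pascal's rule
  \<open>(2n - 2) choose (n - 1)\<close> maps hit \<open>k\<close>.  From these one removes the maps
  for which \<open>k\<close> is the only preimage of \<open>k\<close>.  By monotonicity such a map sends the points below \<open>k\<close>
  to points below \<open>k\<close>, and the points above \<open>k\<close> to points above \<open>k\<close>; these two restrictions are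
  arbitrary, which gives a product of two binomial coefficients.  At \<open>k = 1\<close> and \<open>k = n\<close>
  one of the two factors is \<open>1\<close>, and Pascal's rule simplifies the difference.\<close>

section \<open>Order-preserving maps between finite chains\<close>

definition mono_maps :: "'a::linorder set \<Rightarrow> 'b::linorder set \<Rightarrow> ('a \<Rightarrow> 'b) set" where
  "mono_maps A B = {f \<in> A \<rightarrow>\<^sub>E B. mono_on A f}"

lemma finite_mono_maps: "finite A \<Longrightarrow> finite B \<Longrightarrow> finite (mono_maps A B)"
  by (simp add: mono_maps_def finite_PiE)

text \<open>The recursion behind the count: a map that misses the top \<open>b\<close> of the codomain is a map into
  \<open>B\<close>.  A map that hits \<open>b\<close> must do so at the top \<open>a\<close> of the domain, and its restriction to \<open>A\<close> is
  arbitrary.\<close>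

lemma card_mono_maps_insert:
  fixes A :: "'a::linorder set" and B :: "'b::linorder set"
  assumes fin: "finite A" "finite B"
    and a: "\<And>x. x \<in> A \<Longrightarrow> x < a" and b: "\<And>y. y \<in> B \<Longrightarrow> y < b"
  shows "card (mono_maps (insert a A) (insert b B)) =
    card (mono_maps (insert a A) B) + card (mono_maps A (insert b B))"
proof -
  let ?T = "{f \<in> mono_maps (insert a A) (insert b B). f a = b}"
  have notin: "a \<notin> A" "b \<notin> B"
    using a b by blast+
  have split: "mono_maps (insert a A) (insert b B) = mono_maps (insert a A) B \<union> ?T"
  proof (intro equalityI subsetI)
    fix f assume f: "f \<in> mono_maps (insert a A) (insert b B)"
    have "f x \<in> B" if "f a \<noteq> b" "x \<in> insert a A" for x
    proof -
      have "f x \<le> f a"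
        using f that(2) a[of x] by (auto simp: mono_maps_def mono_on_def less_imp_le)
      moreover have "f a \<in> B" "f x \<in> insert b B"
        using f that by (auto simp: mono_maps_def PiE_iff)
      ultimately show ?thesis
        using b[of "f a"] by auto
    qed
    then show "f \<in> mono_maps (insert a A) B \<union> ?T"
      using f by (cases "f a = b") (auto simp: mono_maps_def PiE_iff)
  qed (auto simp: mono_maps_def PiE_iff)
  have "bij_betw (\<lambda>f. f(a := b)) (mono_maps A (insert b B)) ?T"
  proof (rule bij_betw_byWitness[where f' = "\<lambda>f. f(a := undefined)"])
    show "\<forall>f\<in>mono_maps A (insert b B). (f(a := b))(a := undefined) = f"
      using notin by (auto simp: mono_maps_def PiE_iff extensional_def)
    show "\<forall>f\<in>?T. (f(a := undefined))(a := b) = f"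
      by auto
    show "(\<lambda>f. f(a := b)) ` mono_maps A (insert b B) \<subseteq> ?T"
    proof (rule image_subsetI)
      fix f assume f: "f \<in> mono_maps A (insert b B)"
      have le_b: "f x \<le> b" if "x \<in> A" for x
        using f that b by (fastforce simp: mono_maps_def PiE_iff)
      have "mono_on (insert a A) (f(a := b))"
        using f le_b a by (fastforce simp: mono_maps_def mono_on_def)
      then show "f(a := b) \<in> ?T"
        using f by (auto simp: mono_maps_def PiE_iff extensional_def)
    qed
    show "(\<lambda>f. f(a := undefined)) ` ?T \<subseteq> mono_maps A (insert b B)"
    proof (rule image_subsetI)
      fix f assume f: "f \<in> ?T"
      then have f: "f \<in> insert a A \<rightarrow>\<^sub>E insert b B" and mono: "mono_on (insert a A) f"
        by (simp_all add: mono_maps_def)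
      have "mono_on A (f(a := undefined))"
      proof (rule mono_onI)
        fix r s assume "r \<in> A" "s \<in> A" "r \<le> s"
        then show "(f(a := undefined)) r \<le> (f(a := undefined)) s"
          using mono_onD[OF mono, of r s] notin by (metis fun_upd_other insertI2)
      qed
      then show "f(a := undefined) \<in> mono_maps A (insert b B)"
        using fun_upd_in_PiE[OF notin(1) f] by (simp add: mono_maps_def)
    qed
  qed
  then have "card ?T = card (mono_maps A (insert b B))"
    by (simp add: bij_betw_same_card)
  moreover have "mono_maps (insert a A) B \<inter> ?T = {}"
    using notin by (auto simp: mono_maps_def PiE_iff)
  moreover have "finite (mono_maps (insert a A) B)" "finite ?T"
    using fin by (simp_all add: finite_mono_maps)
  ultimately show ?thesis
    using arg_cong[OF split, of card] card_Un_disjoint[of "mono_maps (insert a A) B" ?T] by metis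
qed

text \<open>The recursion is Pascal's rule, so a nested induction that adds new top elements suffices.
  Truncated subtraction is harmless: with \<open>A\<close> and \<open>B\<close> both empty the right-hand side is
  \<open>0 choose 0\<close>, which counts the empty map.\<close>

lemma card_mono_maps:
  fixes A :: "'a::linorder set" and B :: "'b::linorder set"
  assumes "finite A" "finite B"
  shows "card (mono_maps A B) = (card B + card A - 1) choose card A"
  using assms
proof (induction A arbitrary: B rule: finite_linorder_max_induct)
  case empty
  have "mono_maps ({} :: 'a set) B = {\<lambda>x. undefined}"
    by (auto simp: mono_maps_def mono_on_def)
  then show ?case
    by simp
next
  case (insert a A)
  note A = \<open>finite A\<close> \<open>\<forall>x\<in>A. x < a\<close> and IH = insert.IH
  from insert.prems show ?case
  proof (induction B rule: finite_linorder_max_induct)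
    case empty
    have "mono_maps (insert a A) ({} :: 'b set) = {}"
      by (auto simp: mono_maps_def PiE_iff)
    then show ?case
      using insert.hyps by auto
  next
    case (insert b B)
    have card_ins: "card (insert a A) = Suc (card A)" "card (insert b B) = Suc (card B)"
      using A insert.hyps by auto
    have "card (mono_maps (insert a A) (insert b B)) =
        ((card B + card A) choose Suc (card A)) + ((card B + card A) choose card A)"
      using card_mono_maps_insert[of A B a b] A insert card_ins IH[of "insert b B"]
      by simp
    then show ?case
      using card_ins by simp
  qed
qed

section \<open>Order-preserving maps with a prescribed fibre\<close>

lemma OP_eq_mono_maps: "OP n = mono_maps (X n) (X n)"
  by (simp add: OP_def mono_maps_def)

lemma card_OP_hitting:
  assumes "1 \<le> k" "k \<le> n"
  shows "card {\<alpha> \<in> OP n. k \<in> im n \<alpha>} = (2 * n - 2) choose (n - 1)"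
proof -
  have miss: "{\<alpha> \<in> OP n. k \<in> im n \<alpha>} = OP n - mono_maps (X n) (X n - {k})"
    by (auto simp: OP_def mono_maps_def im_def PiE_iff image_iff)
  have sub: "mono_maps (X n) (X n - {k}) \<subseteq> OP n"
    by (auto simp: OP_def mono_maps_def PiE_iff)
  have fin: "finite (X n)" and card: "card (X n) = n" "card (X n - {k}) = n - 1"
    using assms by (auto simp: X_def)
  have "card {\<alpha> \<in> OP n. k \<in> im n \<alpha>} = card (OP n) - card (mono_maps (X n) (X n - {k}))"
    unfolding miss using sub fin by (intro card_Diff_subset) (simp_all add: finite_mono_maps)
  also have "\<dots> = ((n + n - 1) choose n) - ((n - 1 + n - 1) choose n)"
    using fin card by (simp add: OP_eq_mono_maps card_mono_maps)
  finally have "card {\<alpha> \<in> OP n. k \<in> im n \<alpha>} = \<dots>" .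
  moreover obtain m where "n = Suc m"
    using assms by (cases n) auto
  ultimately show ?thesis
    by (simp add: mult_2)
qed

text \<open>Cutting \<open>X n\<close> at \<open>k\<close>: gluing monotone self-maps of the points below and above \<open>k\<close>, with
  \<open>k\<close> fixed, yields a monotone map whose fibre over \<open>k\<close> is \<open>{k}\<close>, and every such map
  arises in this way.\<close>

lemma card_OP_singleton_fibre:
  assumes "1 \<le> k" "k \<le> n"
  shows "card {\<alpha> \<in> OP n. preimage n \<alpha> k = {k}} =
    ((2 * (k - 1) - 1) choose (k - 1)) * ((2 * (n - k) - 1) choose (n - k))"
proof -
  let ?F = "{\<alpha> \<in> OP n. preimage n \<alpha> k = {k}}"
  let ?L = "{1..<k}" and ?U = "{k<..n}"
  let ?P = "mono_maps ?L ?L \<times> mono_maps ?U ?U"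
  have fibre: "preimage n \<alpha> k = {k} \<longleftrightarrow> (\<forall>x. 1 \<le> x \<and> x \<le> n \<longrightarrow> (\<alpha> x = k \<longleftrightarrow> x = k))" for \<alpha>
    using assms by (auto simp: preimage_def X_def)
  have OP_iff: "\<alpha> \<in> OP n \<longleftrightarrow> (\<forall>x. 1 \<le> x \<and> x \<le> n \<longrightarrow> 1 \<le> \<alpha> x \<and> \<alpha> x \<le> n) \<and>
      (\<forall>x. \<not> (1 \<le> x \<and> x \<le> n) \<longrightarrow> \<alpha> x = undefined) \<and>
      (\<forall>x y. 1 \<le> x \<and> x \<le> y \<and> y \<le> n \<longrightarrow> \<alpha> x \<le> \<alpha> y)" for \<alpha>
    by (auto simp: OP_def X_def PiE_iff extensional_def mono_on_def)
  have "bij_betw (\<lambda>\<alpha>. (restrict \<alpha> ?L, restrict \<alpha> ?U)) ?F ?P"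
  proof (rule bij_betw_byWitness[where f' = "\<lambda>(f, g) x. if x < k then f x else if x = k then k else g x"])
    show "\<forall>\<alpha>\<in>?F. (\<lambda>(f, g) x. if x < k then f x else if x = k then k else g x)
        (restrict \<alpha> ?L, restrict \<alpha> ?U) = \<alpha>"
      using assms by (auto simp: fun_eq_iff OP_iff fibre)
    show "\<forall>p\<in>?P. (\<lambda>\<alpha>. (restrict \<alpha> ?L, restrict \<alpha> ?U))
        ((\<lambda>(f, g) x. if x < k then f x else if x = k then k else g x) p) = p"
      by (auto simp: fun_eq_iff mono_maps_def PiE_iff extensional_def)
    show "(\<lambda>\<alpha>. (restrict \<alpha> ?L, restrict \<alpha> ?U)) ` ?F \<subseteq> ?P"
    proof (rule image_subsetI)
      fix \<alpha> assume "\<alpha> \<in> ?F"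
      then have \<alpha>: "\<alpha> \<in> OP n" and fib: "\<And>x. 1 \<le> x \<Longrightarrow> x \<le> n \<Longrightarrow> \<alpha> x = k \<longleftrightarrow> x = k"
        by (auto simp: fibre)
      have "\<alpha> k = k"
        using fib assms by blast
      have "1 \<le> \<alpha> x \<and> \<alpha> x < k" if "x \<in> ?L" for x
      proof -
        have "\<alpha> x \<le> \<alpha> k" "1 \<le> \<alpha> x" "\<alpha> x \<noteq> k"
          using \<alpha> fib[of x] that assms by (auto simp: OP_iff)
        then show ?thesis
          using \<open>\<alpha> k = k\<close> by auto
      qed
      moreover have "k < \<alpha> x \<and> \<alpha> x \<le> n" if "x \<in> ?U" for x
      proof -
        have "\<alpha> k \<le> \<alpha> x" "\<alpha> x \<le> n" "\<alpha> x \<noteq> k"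
          using \<alpha> fib[of x] that assms by (auto simp: OP_iff)
        then show ?thesis
          using \<open>\<alpha> k = k\<close> by auto
      qed
      moreover have "mono_on ?L \<alpha>" "mono_on ?U \<alpha>"
        using \<alpha> assms by (auto simp: OP_iff mono_on_def)
      ultimately show "(restrict \<alpha> ?L, restrict \<alpha> ?U) \<in> ?P"
        by (auto simp: mono_maps_def mono_on_def)
    qed
    show "(\<lambda>(f, g) x. if x < k then f x else if x = k then k else g x) ` ?P \<subseteq> ?F"
    proof (rule image_subsetI)
      fix p assume "p \<in> ?P"
      then obtain f g where p: "p = (f, g)" and f: "f \<in> mono_maps ?L ?L" and g: "g \<in> mono_maps ?U ?U"
        by blast
      let ?h = "\<lambda>x. if x < k then f x else if x = k then k else g x"
      have fL: "1 \<le> f x \<and> f x < k" if "1 \<le> x" "x < k" for x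
        using f that by (auto simp: mono_maps_def PiE_iff)
      have gU: "k < g x \<and> g x \<le> n" if "k < x" "x \<le> n" for x
        using g that by (auto simp: mono_maps_def PiE_iff)
      have undef: "f 0 = undefined" "\<And>x. n < x \<Longrightarrow> g x = undefined"
        using f g by (auto simp: mono_maps_def PiE_iff extensional_def)
      have fm: "f x \<le> f y" if "1 \<le> x" "x \<le> y" "y < k" for x y
        using f that by (auto simp: mono_maps_def mono_on_def)
      have gm: "g x \<le> g y" if "k < x" "x \<le> y" "y \<le> n" for x y
        using g that by (auto simp: mono_maps_def mono_on_def)
      have mono: "?h x \<le> ?h y" if "1 \<le> x" "x \<le> y" "y \<le> n" for x y
        using that fL[of x] gU[of y] fm[of x y] gm[of x y] by auto
      have range: "1 \<le> ?h x \<and> ?h x \<le> n \<and> (?h x = k \<longleftrightarrow> x = k)" if "1 \<le> x" "x \<le> n" for x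
        using that fL[of x] gU[of x] assms by auto
      have out: "?h x = undefined" if "\<not> (1 \<le> x \<and> x \<le> n)" for x
        using that undef assms by (cases "x = 0") auto
      have "?h \<in> ?F"
        unfolding mem_Collect_eq OP_iff fibre using mono range out by blast
      then show "(\<lambda>(f, g) x. if x < k then f x else if x = k then k else g x) p \<in> ?F"
        by (simp add: p)
    qed
  qed
  then have "card ?F = card ?P"
    by (rule bij_betw_same_card)
  then show ?thesis
    by (simp add: card_cartesian_product card_mono_maps mult_2)
qed

section \<open>Right factors of a constant map\<close>

text \<open>The point \<open>j \<noteq> k\<close> of the preimage that is needed from right to left exists because \<open>k\<close> lies
  in the image: the preimage is then a nonempty set different from \<open>{k}\<close>.\<close>

lemma R_eq_fibre:
  assumes "1 \<le> k" "k \<le> n"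
  shows "R n k = {\<alpha> \<in> OP n. k \<in> im n \<alpha> \<and> preimage n \<alpha> k \<noteq> {k}}"
proof (intro equalityI subsetI)
  fix \<alpha> assume "\<alpha> \<in> R n k"
  then obtain \<gamma> where \<alpha>: "\<alpha> \<in> OP n" and \<gamma>: "\<gamma> \<in> OP n" "\<gamma> \<noteq> const_map n k"
    and eq: "mult n \<gamma> \<alpha> = const_map n k"
    by (auto simp: R_def)
  have \<gamma>X: "\<gamma> x \<in> X n" if "x \<in> X n" for x
    using \<gamma>(1) that by (auto simp: OP_def)
  have val: "\<alpha> (\<gamma> x) = k" if "x \<in> X n" for x
    using fun_cong[OF eq, of x] that by (simp add: mult_def compose_def const_map_def)
  have "1 \<in> X n"
    using assms by (simp add: X_def)
  then have "k \<in> im n \<alpha>"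
    using val[of 1] \<gamma>X[of 1] by (force simp: im_def)
  moreover have "preimage n \<alpha> k \<noteq> {k}"
  proof
    assume single: "preimage n \<alpha> k = {k}"
    have "\<gamma> x = k" if "x \<in> X n" for x
      using single val[OF that] \<gamma>X[OF that] by (auto simp: preimage_def)
    then have "\<gamma> = const_map n k"
      using \<gamma>(1) by (auto simp: fun_eq_iff const_map_def OP_def PiE_iff extensional_def)
    then show False
      using \<gamma>(2) by simp
  qed
  ultimately show "\<alpha> \<in> {\<alpha> \<in> OP n. k \<in> im n \<alpha> \<and> preimage n \<alpha> k \<noteq> {k}}"
    using \<alpha> by simp
next
  fix \<alpha> assume "\<alpha> \<in> {\<alpha> \<in> OP n. k \<in> im n \<alpha> \<and> preimage n \<alpha> k \<noteq> {k}}"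
  then have \<alpha>: "\<alpha> \<in> OP n" and "preimage n \<alpha> k \<noteq> {}" "preimage n \<alpha> k \<noteq> {k}"
    by (auto simp: im_def preimage_def)
  then obtain j where "j \<in> preimage n \<alpha> k" "j \<noteq> k"
    by blast
  then have j: "j \<in> X n" "\<alpha> j = k" "j \<noteq> k"
    by (simp_all add: preimage_def)
  have "const_map n j \<in> OP n"
    using j by (auto simp: OP_def const_map_def mono_on_def)
  moreover have "const_map n j \<noteq> const_map n k"
  proof
    assume "const_map n j = const_map n k"
    from fun_cong[OF this, of j] show False
      using j by (simp add: const_map_def)
  qed
  moreover have "mult n (const_map n j) \<alpha> = const_map n k"
    using j by (simp add: mult_def compose_def const_map_def fun_eq_iff)
  ultimately show "\<alpha> \<in> R n k"
    using \<alpha> by (auto simp: R_def)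
qed

text \<open>One formula for all \<open>k\<close>.  At \<open>k = 1\<close> and \<open>k = n\<close>, truncated subtraction turns
  the factor of the empty side into \<open>0 choose 0 = 1\<close>, as it should be.\<close>

lemma card_R:
  assumes "1 \<le> k" "k \<le> n"
  shows "int (card (R n k)) = int ((2 * n - 2) choose (n - 1)) -
    int ((2 * (k - 1) - 1) choose (k - 1)) * int ((2 * (n - k) - 1) choose (n - k))"
proof -
  let ?H = "{\<alpha> \<in> OP n. k \<in> im n \<alpha>}" and ?F = "{\<alpha> \<in> OP n. preimage n \<alpha> k = {k}}"
  have "finite (OP n)"
    by (simp add: OP_eq_mono_maps finite_mono_maps X_def)
  then have fin: "finite ?H" "finite ?F"
    by simp_all
  have sub: "?F \<subseteq> ?H"
  proof (intro subsetI CollectI conjI)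
    fix \<alpha> assume "\<alpha> \<in> ?F"
    then have "\<alpha> \<in> OP n" "k \<in> preimage n \<alpha> k"
      by simp_all
    then show "\<alpha> \<in> OP n" "k \<in> im n \<alpha>"
      unfolding preimage_def im_def by force+
  qed
  have "R n k = ?H - ?F"
    using R_eq_fibre[OF assms] by auto
  then have "card (R n k) = card ?H - card ?F"
    using sub fin by (simp add: card_Diff_subset)
  then have "int (card (R n k)) = int (card ?H) - int (card ?F)"
    using card_mono[OF fin(1) sub] by (simp add: of_nat_diff)
  then show ?thesis
    by (simp add: card_OP_hitting[OF assms] card_OP_singleton_fibre[OF assms])
qed

text \<open>Pascal's rule together with the symmetry of the binomial coefficients halves \<open>(2 * n - 2) choose (n - 1)\<close>.\<close>

lemma central_binomial_diff:
  assumes "n \<ge> 2"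
  shows "int ((2 * n - 2) choose (n - 1)) - int ((2 * (n - 1) - 1) choose (n - 1)) =
    int ((2 * n - 3) choose (n - 1))"
proof -
  obtain m where n: "n = Suc (Suc m)"
    using assms by (metis Suc_le_D numeral_2_eq_2 Suc_le_mono)
  have "Suc (2 * m) choose m = Suc (2 * m) choose Suc m"
    using binomial_symmetric[of m "Suc (2 * m)"] by simp
  then show ?thesis
    by (simp add: n)
qed

theorem lemma2:
  fixes n k :: nat
  assumes "n \<ge> 2" and "1 \<le> k" and "k \<le> n"
  shows "R n k = {\<alpha> \<in> OP n. k \<in> im n \<alpha> \<and> preimage n \<alpha> k \<noteq> {k}} \<and>
    card (R n 1) = (2 * n - 3) choose (n - 1) \<and>
    card (R n n) = (2 * n - 3) choose (n - 1) \<and>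
    (2 \<le> k \<and> k \<le> n - 1 \<longrightarrow>
      int (card (R n k)) = int ((2 * n - 2) choose (n - 1))
        - int ((2 * k - 3) choose (k - 2)) * int ((2 * n - 2 * k - 1) choose (n - k - 1)))"
proof (intro conjI impI)
  show "R n k = {\<alpha> \<in> OP n. k \<in> im n \<alpha> \<and> preimage n \<alpha> k \<noteq> {k}}"
    using assms by (intro R_eq_fibre)
  show "card (R n 1) = (2 * n - 3) choose (n - 1)"
    using card_R[of 1 n] central_binomial_diff[of n] assms by simp
  show "card (R n n) = (2 * n - 3) choose (n - 1)"
    using card_R[of n n] central_binomial_diff[of n] assms by simp
  assume k: "2 \<le> k \<and> k \<le> n - 1"
  \<comment> \<open>Both factors of \<open>card_R\<close> turn into the stated ones by the symmetry of the binomial coefficients.\<close>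
  have "2 * (k - 1) - 1 = 2 * k - 3" "k - 1 \<le> 2 * k - 3" "2 * k - 3 - (k - 1) = k - 2"
    using k by linarith+
  then have "(2 * (k - 1) - 1) choose (k - 1) = (2 * k - 3) choose (k - 2)"
    using binomial_symmetric[of "k - 1" "2 * k - 3"] by (simp only:)
  moreover have "2 * (n - k) - 1 = 2 * n - 2 * k - 1" "n - k \<le> 2 * n - 2 * k - 1"
      "2 * n - 2 * k - 1 - (n - k) = n - k - 1"
    using k assms by linarith+
  then have "(2 * (n - k) - 1) choose (n - k) = (2 * n - 2 * k - 1) choose (n - k - 1)"
    using binomial_symmetric[of "n - k" "2 * n - 2 * k - 1"] by (simp only:)
  ultimately show "int (card (R n k)) = int ((2 * n - 2) choose (n - 1))
        - int ((2 * k - 3) choose (k - 2)) * int ((2 * n - 2 * k - 1) choose (n - k - 1))"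
    using card_R[of k n] assms by simp
qed

end
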